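(* Let $\mathcal{E}$ be an ellipse with center $O$ and semi-axes $a,b>0$. The signed area $A_p$ of the pedal curve $\mathcal{E}_p$ of $\mathcal{E}$ with respect to a point $M$ is constant as $M$ ranges over any circle centered at $O$ (concentric with $\mathcal{E}$).
   Context: Parametrize $\mathcal{E}$ by $P(t)=(a\cos t,b\sin t)$, $t\in[0,2\pi]$, with center $O=(0,0)$. The pedal curve $\mathcal{E}_p$ with respect to $M$ is $t\mapsto Q_p(t)$, where $Q_p(t)$ is the foot of the perpendicular dropped from $M$ onto the tangent line to $\mathcal{E}$ at $P(t)$. The signed area of a closed parametrized curve $\gamma$ is $\frac12\int_\gamma(x\,dy-y\,dx)$, with orientation given by increasing $t$. *)

theory Defs
  imports "HOL-Analysis.Analysis"
begin

text \<open>The Euclidean plane is \<^typ>\<open>real \<times> real\<close>.  Curves are functions on the whole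
  real line; the relevant parameter interval is given where it matters.\<close>

definition ellipse :: "real \<Rightarrow> real \<Rightarrow> real \<Rightarrow> real \<times> real" where
  "ellipse a b t = (a * cos t, b * sin t)"

definition tangent_line :: "(real \<Rightarrow> real \<times> real) \<Rightarrow> real \<Rightarrow> (real \<times> real) set" where
  "tangent_line \<gamma> t = range (\<lambda>s. \<gamma> t + s *\<^sub>R vector_derivative \<gamma> (at t))"

definition foot :: "(real \<times> real) set \<Rightarrow> real \<times> real \<Rightarrow> real \<times> real" where
  "foot L M = (THE Q. Q \<in> L \<and> (\<forall>X\<in>L. orthogonal (M - Q) (X - Q)))"

definition pedal_curve ::
  "(real \<Rightarrow> real \<times> real) \<Rightarrow> real \<times> real \<Rightarrow> real \<Rightarrow> real \<times> real" where
  "pedal_curve \<gamma> M t = foot (tangent_line \<gamma> t) M"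

text \<open>The derivative is taken within the parameter interval, so that the area depends only on
  the curve over that interval (one-sided derivatives at the end points).\<close>

definition signed_area :: "real \<Rightarrow> real \<Rightarrow> (real \<Rightarrow> real \<times> real) \<Rightarrow> real" where
  "signed_area u v \<gamma> = 1 / 2 * integral {u..v} (\<lambda>t.
     let (x, y) = \<gamma> t; (x', y') = vector_derivative \<gamma> (at t within {u..v})
     in x * y' - y * x')"

text \<open>The definite description in \<^const>\<open>foot\<close> is proper for every tangent line of a
  nondegenerate ellipse.\<close>

lemma foot_unique:
  assumes "v \<noteq> 0"
  shows "\<exists>!Q. Q \<in> range (\<lambda>s. p + s *\<^sub>R v) \<and>
           (\<forall>X \<in> range (\<lambda>s. p + s *\<^sub>R v). orthogonal (M - Q) (X - Q))"
proof (rule ex1I)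
  define c where "c = ((M - p) \<bullet> v) / (v \<bullet> v)"
  have c: "(M - p) \<bullet> v = c * (v \<bullet> v)"
    using assms by (simp add: c_def)
  have key: "orthogonal (M - (p + s *\<^sub>R v)) ((p + r *\<^sub>R v) - (p + s *\<^sub>R v))
      \<longleftrightarrow> (c = s \<or> r = s)" for r s
  proof -
    have "(M - (p + s *\<^sub>R v)) \<bullet> ((p + r *\<^sub>R v) - (p + s *\<^sub>R v))
        = (r - s) * ((M - p) \<bullet> v - s * (v \<bullet> v))"
      by (simp add: algebra_simps)
    also have "\<dots> = (r - s) * (c - s) * (v \<bullet> v)"
      by (simp only: c) (simp add: algebra_simps)
    finally show ?thesis
      using assms by (auto simp: orthogonal_def)
  qed
  show "p + c *\<^sub>R v \<in> range (\<lambda>s. p + s *\<^sub>R v) \<and>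
      (\<forall>X \<in> range (\<lambda>s. p + s *\<^sub>R v). orthogonal (M - (p + c *\<^sub>R v)) (X - (p + c *\<^sub>R v)))"
    using key by blast
  fix Q
  assume Q: "Q \<in> range (\<lambda>s. p + s *\<^sub>R v) \<and>
      (\<forall>X \<in> range (\<lambda>s. p + s *\<^sub>R v). orthogonal (M - Q) (X - Q))"
  then obtain s where s: "Q = p + s *\<^sub>R v"
    by blast
  have "\<forall>r. orthogonal (M - Q) ((p + r *\<^sub>R v) - Q)"
    using Q by blast
  then have "orthogonal (M - (p + s *\<^sub>R v)) ((p + (s + 1) *\<^sub>R v) - (p + s *\<^sub>R v))"
    unfolding s by (rule spec)
  with key[of s "s + 1"] show "Q = p + c *\<^sub>R v"
    by (simp add: s)
qed

lemma vector_derivative_ellipse: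
  "vector_derivative (ellipse a b) (at t) = (- a * sin t, b * cos t)"
proof (rule vector_derivative_at)
  have "((\<lambda>t. (a * cos t, b * sin t)) has_vector_derivative (- a * sin t, b * cos t)) (at t)"
    by (intro has_vector_derivative_Pair)
       (auto intro!: derivative_eq_intros
             simp flip: has_real_derivative_iff_has_vector_derivative)
  then show "(ellipse a b has_vector_derivative (- a * sin t, b * cos t)) (at t)"
    by (simp add: ellipse_def[abs_def])
qed

lemma vector_derivative_ellipse_nonzero:
  assumes "a > 0" "b > 0"
  shows "vector_derivative (ellipse a b) (at t) \<noteq> 0"
  using assms sin_zero_abs_cos_one[of t]
  by (auto simp: vector_derivative_ellipse zero_prod_def)

end

theory Submission
  imports Defs
begin

text \<open>
  Put \<open>n(t) = (b cos t, a sin t)\<close>, a normal to the ellipse at \<open>P(t)\<close>, and \<open>D = n \<bullet> n\<close>.  Since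
  \<open>P \<bullet> n = a b\<close>, the foot of the perpendicular from \<open>M = (p, q)\<close> is \<open>Q = M + \<lambda> n\<close> with
  \<open>\<lambda> = (a b - M \<bullet> n) / D\<close>.  Writing \<open>\<times>\<close> for the planar cross product,
  \<open>Q \<times> Q' = (M \<times> \<lambda> n)' + \<lambda>\<^sup>2 (n \<times> n')\<close> and \<open>n \<times> n' = a b\<close>.  The first term integrates to \<open>0\<close> over
  a period.  In the second, the square \<open>(a b - M \<bullet> n)\<^sup>2\<close> gives three contributions:

  \<^item> \<open>a\<^sup>3 b\<^sup>3 / D\<^sup>2\<close>, which is independent of \<open>M\<close>;
  \<^item> a term linear in \<open>n\<close>, which changes sign under \<open>t \<mapsto> t + \<pi>\<close> (the ellipse is symmetric about
    its centre) and so integrates to \<open>0\<close>;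
  \<^item> \<open>a b (M \<bullet> n)\<^sup>2 / D\<^sup>2\<close>.  If \<open>\<theta>\<close> is the polar angle of \<open>n\<close>, then \<open>d\<theta> = (a b / D) dt\<close>, and this term
    is \<open>(p cos \<theta> + q sin \<theta>)\<^sup>2 d\<theta>\<close>.  Up to the multiples of \<open>cos 2\<theta>\<close> and \<open>sin 2\<theta>\<close>, which have
    periodic antiderivatives, it equals \<open>(p\<^sup>2 + q\<^sup>2) / 2 d\<theta>\<close>.

  Hence the area depends on \<open>M\<close> only through \<open>p\<^sup>2 + q\<^sup>2\<close>, as
  \<open>signed_area_pedal_ellipse\<close> makes explicit.
\<close>

section \<open>The normal of the ellipse\<close>

definition normal_sq :: "real \<Rightarrow> real \<Rightarrow> real \<Rightarrow> real" where
  "normal_sq a b t = (b * cos t)\<^sup>2 + (a * sin t)\<^sup>2"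

text \<open>The factor \<open>\<lambda>\<close> with \<open>Q = M + \<lambda> n\<close>, for \<open>M = (p, q)\<close>.\<close>

definition pedal_coeff :: "real \<Rightarrow> real \<Rightarrow> real \<Rightarrow> real \<Rightarrow> real \<Rightarrow> real" where
  "pedal_coeff a b p q t = (a * b - (p * (b * cos t) + q * (a * sin t))) / normal_sq a b t"

lemma normal_sq_pos:
  assumes "a > 0" "b > 0"
  shows "normal_sq a b t > 0"
proof -
  have "b * cos t \<noteq> 0 \<or> a * sin t \<noteq> 0"
    using assms sin_zero_abs_cos_one[of t] by auto
  then show ?thesis
    by (simp add: normal_sq_def sum_power2_gt_zero_iff)
qed

lemma normal_sq_add_pi [simp]: "normal_sq a b (t + pi) = normal_sq a b t"
  by (simp add: normal_sq_def)

lemma normal_sq_has_derivative [derivative_intros]: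
  "(normal_sq a b has_real_derivative 2 * (a\<^sup>2 - b\<^sup>2) * (sin t * cos t)) (at t within S)"
proof -
  have "((\<lambda>t. (b * cos t)\<^sup>2 + (a * sin t)\<^sup>2) has_real_derivative
          2 * (a\<^sup>2 - b\<^sup>2) * (sin t * cos t)) (at t within S)"
    by (rule derivative_eq_intros refl | simp add: algebra_simps power2_eq_square)+
  then show ?thesis
    by (simp add: normal_sq_def[abs_def])
qed

lemma continuous_on_normal_sq [continuous_intros]: "continuous_on S (normal_sq a b)"
  unfolding normal_sq_def by (intro continuous_intros)

section \<open>The pedal curve of the ellipse\<close>

lemma foot_eqI:
  assumes "v \<noteq> 0" and "Q \<in> range (\<lambda>s. p + s *\<^sub>R v)" and "orthogonal (M - Q) v"
  shows "foot (range (\<lambda>s. p + s *\<^sub>R v)) M = Q"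
  unfolding foot_def
proof (rule the1_equality[OF foot_unique[OF assms(1)]], intro conjI ballI)
  fix X assume "X \<in> range (\<lambda>s. p + s *\<^sub>R v)"
  then obtain s s' where "X = p + s *\<^sub>R v" "Q = p + s' *\<^sub>R v"
    using assms(2) by blast
  then have "X - Q = (s - s') *\<^sub>R v"
    by (simp add: algebra_simps)
  then show "orthogonal (M - Q) (X - Q)"
    using assms(3) by (simp add: orthogonal_def)
qed (fact assms(2))

lemma pedal_curve_ellipse:
  assumes "a > 0" "b > 0"
  shows "pedal_curve (ellipse a b) (p, q) t =
    (p + pedal_coeff a b p q t * (b * cos t), q + pedal_coeff a b p q t * (a * sin t))"
    (is "_ = ?Q")
proof -
  define c s D where "c = cos t" and "s = sin t" and "D = normal_sq a b t"
  have cs: "c\<^sup>2 + s\<^sup>2 = 1" and D: "D = (b * c)\<^sup>2 + (a * s)\<^sup>2" "D \<noteq> 0"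
    using normal_sq_pos[OF assms, of t] by (auto simp: c_def s_def D_def normal_sq_def)
  \<comment> \<open>The tangent vector is \<open>n\<close> turned by a right angle, so it also has squared length \<open>D\<close>, and
    \<open>k\<close> is the coefficient of the orthogonal projection of \<open>M - P\<close> onto it.\<close>
  define k where "k = ((p - a * c) * (- a * s) + (q - b * s) * (b * c)) / D"
  have "D * (p + (a * b - (p * (b * c) + q * (a * s))) / D * (b * c)) = D * (a * c + k * (- a * s))"
    using D(2) unfolding k_def distrib_left
    by (simp, unfold D(1)) (use cs in algebra)
  moreover
  have "D * (q + (a * b - (p * (b * c) + q * (a * s))) / D * (a * s)) = D * (b * s + k * (b * c))"
    using D(2) unfolding k_def distrib_left
    by (simp, unfold D(1)) (use cs in algebra)
  ultimately have "?Q = ellipse a b t + k *\<^sub>R (- a * sin t, b * cos t)"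
    using D(2) by (simp add: pedal_coeff_def ellipse_def flip: c_def s_def D_def)
  then have "?Q \<in> range (\<lambda>s. ellipse a b t + s *\<^sub>R vector_derivative (ellipse a b) (at t))"
    unfolding vector_derivative_ellipse by blast
  moreover have "orthogonal ((p, q) - ?Q) (vector_derivative (ellipse a b) (at t))"
    by (simp add: vector_derivative_ellipse orthogonal_def)
  ultimately show ?thesis
    unfolding pedal_curve_def tangent_line_def
    by (intro foot_eqI vector_derivative_ellipse_nonzero assms)
qed

section \<open>Integrals over a period\<close>

lemma integral_antiperiodic_eq_0:
  fixes f :: "real \<Rightarrow> real"
  assumes "continuous_on {0..2 * T} f" and "T \<ge> 0" and "\<And>t. f (t + T) = - f t"
  shows "integral {0..2 * T} f = 0"
proof -
  have "integral {T..2 * T} f = integral {0..T} (f \<circ> (\<lambda>t. t + T))"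
    using integral_shift[of 0 T T f] continuous_on_subset[OF assms(1), of "{T..2 * T}"] assms(2)
    by simp
  also have "\<dots> = - integral {0..T} f"
    by (simp add: o_def assms(3))
  finally show ?thesis
    using Henstock_Kurzweil_Integration.integral_combine[of 0 T "2 * T" f]
      integrable_continuous_interval[OF assms(1)] assms(2)
    by simp
qed

text \<open>In terms of the polar angle \<open>\<theta>\<close> of the normal, \<open>cos t sin t / D\<close> and \<open>sin\<^sup>2 t / D\<close> are
  \<open>sin 2\<theta> / (2 a b)\<close> and \<open>sin\<^sup>2 \<theta> / a\<^sup>2\<close>, so these are the periodic antiderivatives of the multiples
  of \<open>cos 2\<theta> d\<theta>\<close> and \<open>sin 2\<theta> d\<theta>\<close>.\<close>

lemma double_angle_antiderivatives:
  assumes "a > 0" "b > 0"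
  shows "((\<lambda>t. cos t * sin t / normal_sq a b t) has_real_derivative
            ((b * cos t)\<^sup>2 - (a * sin t)\<^sup>2) / (normal_sq a b t)\<^sup>2) (at t within S)"
    and "((\<lambda>t. (sin t)\<^sup>2 / normal_sq a b t) has_real_derivative
            2 * b\<^sup>2 * (cos t * sin t) / (normal_sq a b t)\<^sup>2) (at t within S)"
proof -
  have D: "normal_sq a b t \<noteq> 0"
    using normal_sq_pos[OF assms, of t] by simp
  have cs: "(cos t)\<^sup>2 + (sin t)\<^sup>2 = 1"
    by simp
  have "((cos t)\<^sup>2 - (sin t)\<^sup>2) * normal_sq a b t
      - cos t * sin t * (2 * (a\<^sup>2 - b\<^sup>2) * (sin t * cos t)) = (b * cos t)\<^sup>2 - (a * sin t)\<^sup>2"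
    unfolding normal_sq_def using cs by algebra
  then show "((\<lambda>t. cos t * sin t / normal_sq a b t) has_real_derivative
      ((b * cos t)\<^sup>2 - (a * sin t)\<^sup>2) / (normal_sq a b t)\<^sup>2) (at t within S)"
    using D by (auto intro!: derivative_eq_intros simp: power2_eq_square algebra_simps)
  have "2 * (sin t * cos t) * normal_sq a b t
      - (sin t)\<^sup>2 * (2 * (a\<^sup>2 - b\<^sup>2) * (sin t * cos t)) = 2 * b\<^sup>2 * (cos t * sin t)"
    unfolding normal_sq_def using cs by algebra
  then show "((\<lambda>t. (sin t)\<^sup>2 / normal_sq a b t) has_real_derivative
      2 * b\<^sup>2 * (cos t * sin t) / (normal_sq a b t)\<^sup>2) (at t within S)"
    using D by (auto intro!: derivative_eq_intros simp: power2_eq_square algebra_simps)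
qed

section \<open>The area of the pedal curve\<close>

text \<open>The integrand \<open>Q \<times> Q'\<close> differs from the one on the right by a periodic function's derivative
  and a function that is antiperiodic with respect to \<open>\<pi>\<close>; both integrate to \<open>0\<close>.\<close>

theorem signed_area_pedal_ellipse:
  assumes "a > 0" "b > 0"
  shows "signed_area 0 (2 * pi) (pedal_curve (ellipse a b) (p, q)) =
    1 / 2 * integral {0..2 * pi} (\<lambda>t. (a * b) ^ 3 / (normal_sq a b t)\<^sup>2
                                      + (p\<^sup>2 + q\<^sup>2) * (a * b / (2 * normal_sq a b t)))"
    (is "_ = 1 / 2 * integral ?I ?E")
proof -
  let ?D = "normal_sq a b"
  let ?l = "pedal_coeff a b p q"
  have D: "?D t \<noteq> 0" for t
    using normal_sq_pos[OF assms, of t] by simp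
  have "\<exists>l'. (?l has_real_derivative l') (at t)" for t
    unfolding pedal_coeff_def using D by (auto intro!: exI derivative_eq_intros)
  then obtain l' where l': "(?l has_real_derivative l' t) (at t)" for t
    by metis
  define x' where "x' t = l' t * (b * cos t) - ?l t * (b * sin t)" for t
  define y' where "y' t = l' t * (a * sin t) + ?l t * (a * cos t)" for t
  have dx: "((\<lambda>t. ?l t * (b * cos t)) has_real_derivative x' t) (at t within S)" for t S
    unfolding x'_def
    by (rule derivative_eq_intros DERIV_subset[OF l'] refl | simp)+
  have dy: "((\<lambda>t. ?l t * (a * sin t)) has_real_derivative y' t) (at t within S)" for t S
    unfolding y'_def
    by (rule derivative_eq_intros DERIV_subset[OF l'] refl | simp)+
  have vd: "vector_derivative (pedal_curve (ellipse a b) (p, q)) (at t within ?I) = (x' t, y' t)"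
    if "t \<in> ?I" for t
  proof (rule vector_derivative_at_within_ivl)
    have "((\<lambda>t. (p + ?l t * (b * cos t), q + ?l t * (a * sin t)))
        has_vector_derivative (x' t, y' t)) (at t)"
      using DERIV_add[OF DERIV_const dx] DERIV_add[OF DERIV_const dy]
      by (intro has_vector_derivative_Pair)
         (simp_all flip: has_real_derivative_iff_has_vector_derivative)
    moreover have "pedal_curve (ellipse a b) (p, q)
        = (\<lambda>t. (p + ?l t * (b * cos t), q + ?l t * (a * sin t)))"
      by (rule ext) (rule pedal_curve_ellipse[OF assms])
    ultimately show "(pedal_curve (ellipse a b) (p, q) has_vector_derivative (x' t, y' t)) (at t)"
      by simp
  qed (use that in auto)

  \<comment> \<open>\<open>f\<close> is the part linear in \<open>n\<close>.  \<open>G\<close> is periodic: it is \<open>M \<times> \<lambda> n\<close> plus the antiderivatives of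
    the \<open>cos 2\<theta>\<close> and \<open>sin 2\<theta>\<close> parts of \<open>a b (M \<bullet> n)\<^sup>2 / D\<^sup>2\<close>.\<close>
  define f where "f t = 2 * (a * b)\<^sup>2 * (p * (b * cos t) + q * (a * sin t)) / (?D t)\<^sup>2" for t
  define G where "G t = p * (?l t * (a * sin t)) - q * (?l t * (b * cos t))
      + (p\<^sup>2 - q\<^sup>2) / 2 * (a * b) * (cos t * sin t / ?D t)
      + p * q * a\<^sup>2 * ((sin t)\<^sup>2 / ?D t)" for t
  define g where "g t = p * y' t - q * x' t
      + (p\<^sup>2 - q\<^sup>2) / 2 * (a * b) * (((b * cos t)\<^sup>2 - (a * sin t)\<^sup>2) / (?D t)\<^sup>2)
      + p * q * a\<^sup>2 * (2 * b\<^sup>2 * (cos t * sin t) / (?D t)\<^sup>2)" for t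
  have "(G has_real_derivative g t) (at t within S)" for t S
    unfolding G_def g_def
    by (intro derivative_intros DERIV_cmult dx dy double_angle_antiderivatives assms)
  then have "(g has_integral G (2 * pi) - G 0) ?I"
    by (intro fundamental_theorem_of_calculus)
       (auto simp flip: has_real_derivative_iff_has_vector_derivative)
  then have g: "(g has_integral 0) ?I"
    by (simp add: G_def pedal_coeff_def normal_sq_def)

  have cf: "continuous_on ?I f" and cE: "continuous_on ?I ?E"
    unfolding f_def using D by (auto intro!: continuous_intros)
  have "integral ?I f = 0"
    using cf by (rule integral_antiperiodic_eq_0) (simp_all add: f_def algebra_simps add_divide_distrib diff_divide_distrib)
  then have f: "(f has_integral 0) ?I"
    using integrable_continuous_interval[OF cf] by (simp add: has_integral_iff)
  have E: "(?E has_integral integral ?I ?E) ?I"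
    using integrable_continuous_interval[OF cE] by (rule integrable_integral)

  have split: "(p + ?l t * (b * cos t)) * y' t - (q + ?l t * (a * sin t)) * x' t
      = ?E t - f t + g t" for t
  proof -
    define u v where "u = b * cos t" and "v = a * sin t"
    have Duv: "?D t = u\<^sup>2 + v\<^sup>2"
      by (simp add: u_def v_def normal_sq_def)
    \<comment> \<open>The identity \<open>\<lambda> n \<times> (\<lambda> n)' = \<lambda>\<^sup>2 (n \<times> n')\<close>, in which \<open>l'\<close> has cancelled.\<close>
    have "(?l t * (b * cos t)) * y' t - (?l t * (a * sin t)) * x' t
        = (?l t)\<^sup>2 * (a * b) * ((cos t)\<^sup>2 + (sin t)\<^sup>2)"
      unfolding x'_def y'_def by algebra
    also have "\<dots> = (a * b) * (a * b - (p * u + q * v))\<^sup>2 / (?D t)\<^sup>2"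
      by (simp add: pedal_coeff_def u_def v_def power_divide)
    \<comment> \<open>Here \<open>p\<^sup>2 u\<^sup>2 + q\<^sup>2 v\<^sup>2\<close> is written through \<open>u\<^sup>2 + v\<^sup>2\<close> and \<open>u\<^sup>2 - v\<^sup>2\<close>, which is the step
      \<open>cos\<^sup>2 \<theta> = (1 + cos 2\<theta>) / 2\<close>.\<close>
    also have "(a * b) * (a * b - (p * u + q * v))\<^sup>2 =
        (a * b) ^ 3 + (p\<^sup>2 + q\<^sup>2) * (a * b / 2) * ?D t - 2 * (a * b)\<^sup>2 * (p * u + q * v)
        + (p\<^sup>2 - q\<^sup>2) / 2 * (a * b) * (u\<^sup>2 - v\<^sup>2) + 2 * p * q * (a * b) * (u * v)"
      unfolding Duv by (simp add: field_simps power2_eq_square power3_eq_cube)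
    also have "\<dots> / (?D t)\<^sup>2 = ?E t - f t + (g t - (p * y' t - q * x' t))"
      using D[of t] unfolding f_def g_def u_def v_def
      by (simp add: field_simps power2_eq_square)
    finally show ?thesis
      by (simp add: algebra_simps)
  qed
  have "((\<lambda>t. ?E t - f t + g t) has_integral integral ?I ?E - 0 + 0) ?I"
    by (intro has_integral_add has_integral_diff E f g)
  then have "integral ?I (\<lambda>t. ?E t - f t + g t) = integral ?I ?E"
    by (simp add: integral_unique)
  moreover have "integral ?I (\<lambda>t. let (x, y) = pedal_curve (ellipse a b) (p, q) t;
        (x', y') = vector_derivative (pedal_curve (ellipse a b) (p, q)) (at t within ?I)
        in x * y' - y * x') = integral ?I (\<lambda>t. ?E t - f t + g t)"
    by (rule integral_cong) (simp add: vd pedal_curve_ellipse[OF assms] split)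
  ultimately show ?thesis
    unfolding signed_area_def by simp
qed

theorem corollary1:
  fixes a b r :: real
  assumes "a > 0" and "b > 0" and "r > 0"
  shows "(\<lambda>M. signed_area 0 (2 * pi) (pedal_curve (ellipse a b) M))
           constant_on sphere (0, 0) r"
proof -
  have "(fst M)\<^sup>2 + (snd M)\<^sup>2 = r\<^sup>2" if "M \<in> sphere (0, 0) r" for M :: "real \<times> real"
  proof -
    have "sqrt ((fst M)\<^sup>2 + (snd M)\<^sup>2) = r"
      using that by (simp add: dist_norm norm_prod_def)
    then show ?thesis
      by (metis real_sqrt_pow2 sum_power2_ge_zero)
  qed
  then have "signed_area 0 (2 * pi) (pedal_curve (ellipse a b) M) =
      1 / 2 * integral {0..2 * pi} (\<lambda>t. (a * b) ^ 3 / (normal_sq a b t)\<^sup>2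
                                        + r\<^sup>2 * (a * b / (2 * normal_sq a b t)))"
    if "M \<in> sphere (0, 0) r" for M
    using that signed_area_pedal_ellipse[OF assms(1,2), of "fst M" "snd M"] by simp
  then show ?thesis
    unfolding constant_on_def by blast
qed

end
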